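(* Let $G_4(s)=1+2^s+3^s+4^s$ for $s\in\mathbb{C}$, and let $R_4:=\overline{\{\operatorname{Re} s: s\in\mathbb{C},\ G_4(s)=0\}}$. Then $[-0.55,1]\subset R_4$.
   Context: The overline denotes closure in $\mathbb{R}$; $m^s=e^{s\log m}$ with $\log m$ the real logarithm. *)

theory Defs
  imports "HOL-Analysis.Analysis"
begin

text \<open>Complex \<open>powr\<close> uses the principal logarithm \<open>Ln\<close>, which on positive reals
  is the real logarithm.\<close>

definition G4 :: "complex \<Rightarrow> complex" where
  "G4 s = 1 + 2 powr s + 3 powr s + 4 powr s"

definition R4 :: "real set" where
  "R4 = closure {Re s | s. G4 s = 0}"

end

theory Submission
  imports Defs "HOL-Complex_Analysis.Great_Picard"
begin

text \<open>Since \<open>ln 2\<close> and \<open>ln 3\<close> are rationally independent, the vertical translates of \<open>G4\<close>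
  accumulate, by Kronecker's theorem, at every function
  \<open>1 + w 2\<^sup>z + v 3\<^sup>z + w\<^sup>2 4\<^sup>z\<close> with \<open>\<bar>w\<bar> = \<bar>v\<bar> = 1\<close>. By Hurwitz's theorem, \<open>\<sigma> \<in> R4\<close> as soon
  as one of these functions vanishes at \<open>\<sigma>\<close>, that is, as soon as
  \<open>\<bar>1 + r w + r\<^sup>2 w\<^sup>2\<bar> = 3\<^sup>\<sigma>\<close> has a solution on the unit circle, where \<open>r = 2\<^sup>\<sigma>\<close>. The left-hand side
  takes the value \<open>1 + r + r\<^sup>2 > 3\<^sup>\<sigma>\<close> at \<open>w = 1\<close> and has minimum \<open>(\<surd>3/2) \<bar>1 - r\<^sup>2\<bar>\<close>, which is at most
  \<open>3\<^sup>\<sigma>\<close> in the given range.\<close>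

section \<open>Vertical translates of \<open>G4\<close>\<close>

lemma powr_add_imaginary:
  assumes "a > 0"
  shows "of_real a powr (z + \<i> * of_real t) = cis (t * ln a) * of_real a powr z"
  using assms by (simp add: powr_def Ln_of_real cis_conv_exp exp_add [symmetric] algebra_simps)

lemma four_powr: "(4::complex) powr z = (2 powr z)\<^sup>2"
proof -
  have "(2 * 2 :: complex) powr z = 2 powr z * 2 powr z"
    using powr_times_real_left [of 2 2 z] by simp
  then show ?thesis
    by (simp add: power2_eq_square)
qed

text \<open>Because 4 is the square of 2, its phase is the square of the phase of 2. Only two phases
  are therefore independent, which is why the last term is kept as a square.\<close>

lemma G4_add_imaginary:
  "G4 (z + \<i> * of_real t) =
    1 + cis (t * ln 2) * 2 powr z + cis (t * ln 3) * 3 powr z + (cis (t * ln 2) * 2 powr z)\<^sup>2"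
  using powr_add_imaginary [of 2 z t] powr_add_imaginary [of 3 z t]
  by (simp add: G4_def four_powr)

section \<open>Kronecker's theorem for \<open>ln 2\<close> and \<open>ln 3\<close>\<close>

lemma log_2_3_irrational: "ln 3 / ln 2 \<notin> (\<rat> :: real set)"
proof
  assume "ln 3 / ln 2 \<in> (\<rat> :: real set)"
  then obtain m n :: int where n: "n > 0" and eq: "ln 3 / ln 2 = (of_int m / of_int n :: real)"
    by (metis Rats_cases')
  have "ln 3 / ln 2 > (0::real)"
    by simp
  then have "m > 0"
    using n eq by (simp add: zero_less_divide_iff)
  define p q where "p = nat m" and "q = nat n"
  have pq: "p > 0" "q > 0" "of_int m = real p" "of_int n = real q"
    using \<open>m > 0\<close> n by (auto simp: p_def q_def)
  have "ln ((3::real) ^ q) = ln (2 ^ p)"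
    using eq pq by (simp add: ln_realpow field_simps)
  then have "(3::real) ^ q = 2 ^ p"
    by simp
  then have "(3::nat) ^ q = 2 ^ p"
    by (metis of_nat_eq_iff of_nat_numeral of_nat_power)
  moreover have "odd ((3::nat) ^ q)" "even ((2::nat) ^ p)"
    using pq by simp_all
  ultimately show False
    by simp
qed

text \<open>Solving \<open>cis (t * ln 2) = w\<close> exactly leaves
  \<open>t = (a + 2 * pi * k) / ln 2\<close> with \<open>k\<close> an arbitrary integer. The other
  angle is then \<open>(a + 2 * pi * k) * \<beta>\<close>, and these are dense modulo
  \<open>2 * pi\<close> since \<open>\<beta>\<close> is irrational.\<close>

lemma Kronecker_2_3:
  assumes "norm w = 1" "norm v = 1" "\<epsilon> > 0"
  obtains t where "cis (t * ln 2) = w" "dist (cis (t * ln 3)) v < \<epsilon>"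
proof -
  obtain a b where w: "w = cis a" and v: "v = cis b"
    using assms complex_norm_eq_1_exp [of w] complex_norm_eq_1_exp [of v]
    by (metis cis_conv_exp)
  have "isCont cis b"
    unfolding isCont_def by (intro tendsto_intros)
  then obtain \<delta> where "\<delta> > 0" and \<delta>: "\<And>x. dist x b < \<delta> \<Longrightarrow> dist (cis x) (cis b) < \<epsilon>"
    using \<open>\<epsilon> > 0\<close> unfolding continuous_at_eps_delta by metis
  define \<beta> :: real where "\<beta> = ln 3 / ln 2"
  \<comment> \<open>The target and tolerance are those for the angle \<open>b\<close>, after
    subtracting the fixed part \<open>a * \<beta>\<close> and rescaling a full turn to 1;
    \<open>h\<close> counts the turns to discard.\<close>
  obtain h k where "\<bar>of_int k * \<beta> - of_int h - (b - a * \<beta>) / (2 * pi)\<bar> < \<delta> / (2 * pi)"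
    using sequence_of_fractional_parts_is_dense [of \<beta> "\<delta> / (2 * pi)"] log_2_3_irrational \<open>\<delta> > 0\<close>
    unfolding \<beta>_def by (metis divide_pos_pos mult_pos_pos pi_gt_zero zero_less_numeral)
  then have "2 * pi * \<bar>of_int k * \<beta> - of_int h - (b - a * \<beta>) / (2 * pi)\<bar> < \<delta>"
    by (simp add: field_simps)
  also have "2 * pi * \<bar>of_int k * \<beta> - of_int h - (b - a * \<beta>) / (2 * pi)\<bar> =
      \<bar>2 * pi * (of_int k * \<beta> - of_int h - (b - a * \<beta>) / (2 * pi))\<bar>"
    by (simp add: abs_mult)
  also have "2 * pi * (of_int k * \<beta> - of_int h - (b - a * \<beta>) / (2 * pi)) =
      ((a + 2 * pi * of_int k) * \<beta> - 2 * pi * of_int h) - b"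
    by (simp add: field_simps)
  finally have close: "dist ((a + 2 * pi * of_int k) * \<beta> - 2 * pi * of_int h) b < \<delta>"
    by (simp add: dist_real_def)
  show thesis
  proof
    have "(a + 2 * pi * of_int k) / ln 2 * ln 2 = a + 2 * pi * of_int k"
      by simp
    then show "cis ((a + 2 * pi * of_int k) / ln 2 * ln 2) = w"
      by (simp only: w cis_mult [symmetric] cis_multiple_2pi Ints_of_int mult_1_right)
    have "(a + 2 * pi * of_int k) / ln 2 * ln 3 =
        ((a + 2 * pi * of_int k) * \<beta> - 2 * pi * of_int h) + 2 * pi * of_int h"
      by (simp add: \<beta>_def)
    then have "cis ((a + 2 * pi * of_int k) / ln 2 * ln 3) =
        cis ((a + 2 * pi * of_int k) * \<beta> - 2 * pi * of_int h)"
      by (metis Ints_of_int cis_mult cis_multiple_2pi mult_1_right)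
    then show "dist (cis ((a + 2 * pi * of_int k) / ln 2 * ln 3)) v < \<epsilon>"
      using \<delta> [OF close] v by simp
  qed
qed

section \<open>Inequalities between powers of 2, 3 and 4\<close>

lemma three_powr_less:
  assumes "\<sigma> \<le> (1::real)"
  shows "3 powr \<sigma> < 1 + 2 powr \<sigma> + (2 powr \<sigma>)\<^sup>2"
proof -
  have *: "(2 powr \<sigma>)\<^sup>2 = 4 powr \<sigma>"
    using powr_mult [of 2 2 \<sigma>] by (simp add: power2_eq_square)
  have "3 powr \<sigma> \<le> 1 + 4 powr \<sigma>"
  proof (cases "\<sigma> \<ge> 0")
    case True
    then have "3 powr \<sigma> \<le> 4 powr \<sigma>"
      by (intro powr_mono2) auto
    then show ?thesis by simp
  next
    case False
    then have "3 powr \<sigma> \<le> 3 powr 0"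
      by (intro powr_mono) auto
    then have "3 powr \<sigma> \<le> 1"
      by simp
    then show ?thesis
      using powr_ge_zero [of 4 \<sigma>] by linarith
  qed
  \<comment> \<open>This term makes the inequality strict; strictness later shows that the limit
    function is not identically zero.\<close>
  moreover have "2 powr \<sigma> > 0"
    by simp
  ultimately show ?thesis
    unfolding * by linarith
qed

text \<open>The constant 1.15 is a rational number just below \<open>2 / sqrt 3\<close>, so that
  \<open>3/4 * 1.15\<^sup>2 \<le> 1\<close>.\<close>

lemma three_powr_ge:
  assumes "- 0.55 \<le> \<sigma>" "\<sigma> \<le> (1::real)"
  shows "3 / 4 * (1 - (2 powr \<sigma>)\<^sup>2)\<^sup>2 \<le> (3 powr \<sigma>)\<^sup>2"
proof -
  have *: "(2 powr \<sigma>)\<^sup>2 = 4 powr \<sigma>"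
    using powr_mult [of 2 2 \<sigma>] by (simp add: power2_eq_square)
  have "\<bar>1 - 4 powr \<sigma>\<bar> \<le> 1.15 * 3 powr \<sigma>"
  proof (cases "\<sigma> \<ge> 0")
    case True
    have "4 powr \<sigma> = (4/3) powr \<sigma> * 3 powr \<sigma>"
      using powr_mult [of "4/3" 3 \<sigma>] by simp
    moreover have "(4/3) powr \<sigma> \<le> (4/3) powr (1::real)"
      using assms by (intro powr_mono) auto
    moreover have "3 powr \<sigma> \<le> 3 powr (1::real)"
      using assms by (intro powr_mono) auto
    \<comment> \<open>With \<open>x = 3 powr \<sigma> \<le> 3\<close> one has
      \<open>4/3 * x - 1 \<le> x\<close>.\<close>
    ultimately have "4 powr \<sigma> \<le> 4/3 * 3 powr \<sigma>" "3 powr \<sigma> \<le> 3"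
      by (auto intro: mult_right_mono)
    moreover have "(4::real) powr \<sigma> \<ge> 1"
      using True by (intro ge_one_powr_ge_zero) auto
    ultimately show ?thesis
      by (simp add: abs_if)
  next
    case False
    \<comment> \<open>Here 11/20 is the endpoint 0.55. Taking 20th powers reduces
      \<open>3 powr 0.55 \<le> 1.9\<close> to the rational inequality
      \<open>3 ^ 11 \<le> 1.9 ^ 20\<close>.\<close>
    have "(3::real) powr (11/20) \<le> ((19/10) ^ 20) powr (1/20)"
    proof -
      have "(3::real) powr (11/20) = (3 ^ 11) powr (1/20)"
        using powr_powr [of 3 11 "1/20"] by simp
      also have "\<dots> \<le> ((19/10) ^ 20) powr (1/20)"
        by (intro powr_mono2) (auto simp: field_simps)
      finally show ?thesis .
    qed
    also have "((19/10) ^ 20) powr (1/20) = (19/10 :: real)"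
    proof -
      have "((19/10) ^ 20) powr (1/20) = ((19/10) powr 20) powr (1/20 :: real)"
        by (subst powr_numeral) auto
      then show ?thesis
        unfolding powr_powr by simp
    qed
    finally have "(3::real) powr (11/20) \<le> 1.9"
      by simp
    moreover have "(3::real) powr (- \<sigma>) \<le> 3 powr (11/20)"
      using assms by (intro powr_mono) auto
    ultimately have "(3::real) powr (- \<sigma>) \<le> 1.9"
      by (rule order_trans [rotated])
    then have "3 powr (-\<sigma>) * 3 powr \<sigma> \<le> 1.9 * 3 powr \<sigma>"
      by (intro mult_right_mono) auto
    then have 1: "1 \<le> 1.9 * 3 powr \<sigma>"
      by (simp flip: powr_add)
    \<comment> \<open>The lower bound 3/4 for \<open>(4/3) powr \<sigma>\<close> suffices, because
      1.9 - 0.75 is exactly 1.15.\<close>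
    have "(4/3) powr (-1::real) \<le> (4/3) powr \<sigma>"
      using assms by (intro powr_mono) auto
    then have "3/4 * 3 powr \<sigma> \<le> (4/3) powr \<sigma> * 3 powr \<sigma>"
      by (intro mult_right_mono) (auto simp: powr_minus)
    also have "\<dots> = 4 powr \<sigma>"
      using powr_mult [of "4/3" 3 \<sigma>] by simp
    finally have "1 - 4 powr \<sigma> \<le> 1.15 * 3 powr \<sigma>"
      using 1 by simp
    moreover have "4 powr \<sigma> \<le> 4 powr (0::real)"
      using False by (intro powr_mono) auto
    ultimately show ?thesis
      by simp
  qed
  then have "\<bar>1 - 4 powr \<sigma>\<bar>\<^sup>2 \<le> (1.15 * 3 powr \<sigma>)\<^sup>2"
    by (intro power_mono) auto
  then have "(1 - 4 powr \<sigma>)\<^sup>2 \<le> 529/400 * (3 powr \<sigma>)\<^sup>2"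
    by (simp add: power_mult_distrib power_divide)
  moreover have "(3 powr \<sigma>)\<^sup>2 \<ge> 0"
    by simp
  ultimately show ?thesis
    unfolding * by linarith
qed

section \<open>The quadratic on the unit circle\<close>

lemma norm_quadratic_cis:
  "(norm (1 + of_real r * cis x + (of_real r * cis x)\<^sup>2))\<^sup>2 =
    (2 * r * cos x + (1 + r\<^sup>2) / 2)\<^sup>2 + 3 / 4 * (1 - r\<^sup>2)\<^sup>2"
proof -
  have "(norm (1 + of_real r * cis x + (of_real r * cis x)\<^sup>2))\<^sup>2 =
      (1 + r * cos x + r\<^sup>2 * ((cos x)\<^sup>2 - (sin x)\<^sup>2))\<^sup>2 + (r * sin x + r\<^sup>2 * (2 * cos x * sin x))\<^sup>2"
    by (simp add: cmod_power2) (simp add: power2_eq_square algebra_simps)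
  also have "\<dots> = (1 + r * cos x + r\<^sup>2 * (2 * (cos x)\<^sup>2 - 1))\<^sup>2 + (sin x)\<^sup>2 * (r + r\<^sup>2 * (2 * cos x))\<^sup>2"
  proof -
    have "(cos x)\<^sup>2 - (sin x)\<^sup>2 = 2 * (cos x)\<^sup>2 - 1"
      by (simp add: sin_squared_eq)
    moreover have "r * sin x + r\<^sup>2 * (2 * cos x * sin x) = sin x * (r + r\<^sup>2 * (2 * cos x))"
      by (simp add: algebra_simps)
    ultimately show ?thesis
      by (simp only: power_mult_distrib)
  qed
  \<comment> \<open>Completing the square in \<open>cos x\<close> leaves a remainder free of
    \<open>x\<close>, which is the squared minimum whenever the first square can vanish.\<close>
  also have "\<dots> = (2 * r * cos x + (1 + r\<^sup>2) / 2)\<^sup>2 + 3 / 4 * (1 - r\<^sup>2)\<^sup>2"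
  proof -
    have 1: "4 * ((1 + r * c + r\<^sup>2 * (2 * c\<^sup>2 - 1))\<^sup>2 + (1 - c\<^sup>2) * (r + r\<^sup>2 * (2 * c))\<^sup>2) =
        (4 * r * c + (1 + r\<^sup>2))\<^sup>2 + 3 * (1 - r\<^sup>2)\<^sup>2" for c
      by algebra
    have 2: "(2 * r * c + (1 + r\<^sup>2) / 2)\<^sup>2 = (4 * r * c + (1 + r\<^sup>2))\<^sup>2 / 4" for c
    proof -
      have "2 * r * c + (1 + r\<^sup>2) / 2 = (4 * r * c + (1 + r\<^sup>2)) / 2"
        by simp
      then show ?thesis
        by (simp only: power_divide) simp
    qed
    have 3: "L = M / 4 + 3 / 4 * N" if "4 * L = M + 3 * N" for L M N :: real
      using that by simp
    show ?thesis
      unfolding sin_squared_eq 2 by (rule 3) (rule 1)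
  qed
  finally show ?thesis .
qed

text \<open>The intermediate value theorem yields \<open>w\<close> for which the quadratic has
  modulus \<open>3 powr \<sigma>\<close>; the phase \<open>v\<close> is then chosen to cancel
  it.\<close>

lemma exists_limit_zero:
  assumes "- 0.55 \<le> \<sigma>" "\<sigma> \<le> (1::real)"
  obtains w v :: complex where "norm w = 1" "norm v = 1"
    "1 + w * of_real (2 powr \<sigma>) + v * of_real (3 powr \<sigma>) + (w * of_real (2 powr \<sigma>))\<^sup>2 = 0"
proof -
  define r where "r = 2 powr \<sigma>"
  define f where "f x = norm (1 + of_real r * cis x + (of_real r * cis x)\<^sup>2)" for x
  have "2 powr (-1) \<le> r" "r \<le> 2 powr 1"
    unfolding r_def using assms by (intro powr_mono; simp)+
  then have r: "1/2 \<le> r" "r \<le> 2"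
    by (auto simp: powr_minus)
  then have "(r - 1/2) * (r - 2) \<le> 0"
    by (intro mult_nonneg_nonpos) auto
  also have "(r - 1/2) * (r - 2) = r\<^sup>2 - 5/2 * r + 1"
    by (simp add: power2_eq_square field_simps)
  finally have "1 + r\<^sup>2 \<le> 4 * r"
    using r by simp
  \<comment> \<open>The cosine at which the completed square vanishes;
    \<open>1 + r\<^sup>2 \<le> 4 * r\<close> places it in [-1, 1].\<close>
  define c where "c = - (1 + r\<^sup>2) / (4 * r)"
  have "- (1 + r\<^sup>2) \<le> 1 * (4 * r)"
    using r zero_le_power2 [of r] by linarith
  then have "c \<le> 1"
    unfolding c_def using r by (subst pos_divide_le_eq) auto
  have "-1 \<le> c"
    unfolding c_def using r \<open>1 + r\<^sup>2 \<le> 4 * r\<close> by (subst pos_le_divide_eq) auto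
  then have "cos (arccos c) = c" "0 \<le> arccos c"
    using \<open>c \<le> 1\<close> by (auto simp: arccos_lbound)
  have "(f (arccos c))\<^sup>2 = 3 / 4 * (1 - r\<^sup>2)\<^sup>2"
  proof -
    have "2 * r * c + (1 + r\<^sup>2) / 2 = 0"
      using r by (simp add: c_def field_simps)
    then show ?thesis
      by (simp add: f_def norm_quadratic_cis \<open>cos (arccos c) = c\<close>)
  qed
  then have "(f (arccos c))\<^sup>2 \<le> (3 powr \<sigma>)\<^sup>2"
    using three_powr_ge [OF assms] by (simp add: r_def)
  then have lo: "f (arccos c) \<le> 3 powr \<sigma>"
    by (rule power2_le_imp_le) simp
  have "f 0 = norm (of_real (1 + r + r\<^sup>2) :: complex)"
    by (simp add: f_def)
  then have hi: "3 powr \<sigma> \<le> f 0"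
    using r three_powr_less [of \<sigma>] assms unfolding norm_of_real r_def by simp
  have "continuous_on {0..arccos c} f"
    unfolding f_def by (intro continuous_intros)
  then obtain x where x: "f x = 3 powr \<sigma>"
    using IVT2' [OF lo hi \<open>0 \<le> arccos c\<close>] by auto
  define u where "u = 1 + cis x * of_real r + (cis x * of_real r)\<^sup>2"
  have u: "norm u = 3 powr \<sigma>"
    using x by (simp add: u_def f_def mult.commute)
  show thesis
  proof
    show "norm (cis x) = 1"
      by simp
    show "norm (- u / of_real (3 powr \<sigma>)) = 1"
      by (simp add: norm_divide u)
    show "1 + cis x * of_real (2 powr \<sigma>) + - u / of_real (3 powr \<sigma>) * of_real (3 powr \<sigma>)
        + (cis x * of_real (2 powr \<sigma>))\<^sup>2 = 0"
      by (simp add: u_def r_def)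
  qed
qed

section \<open>Passage to the limit by Hurwitz's theorem\<close>

theorem corollary2:
  shows "{- 0.55 .. 1} \<subseteq> R4"
proof
  fix \<sigma> :: real
  assume "\<sigma> \<in> {- 0.55 .. 1}"
  then have \<sigma>: "- 0.55 \<le> \<sigma>" "\<sigma> \<le> 1"
    by auto
  obtain w v :: complex where wv: "norm w = 1" "norm v = 1"
    and zero: "1 + w * of_real (2 powr \<sigma>) + v * of_real (3 powr \<sigma>) + (w * of_real (2 powr \<sigma>))\<^sup>2 = 0"
    using exists_limit_zero [OF \<sigma>] by metis
  define g where "g z = 1 + w * 2 powr z + v * 3 powr z + (w * 2 powr z)\<^sup>2" for z
  have g\<sigma>: "g (of_real \<sigma>) = 0"
    using zero powr_of_real [of 2 \<sigma>] powr_of_real [of 3 \<sigma>] by (simp add: g_def)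
  show "\<sigma> \<in> R4"
    unfolding R4_def closure_approachable
  proof (intro allI impI, rule ccontr)
    fix e :: real
    assume "e > 0" and "\<not> (\<exists>y\<in>{Re s |s. G4 s = 0}. dist y \<sigma> < e)"
    then have nz: "G4 s \<noteq> 0" if "dist (Re s) \<sigma> < e" for s
      using that by blast
    \<comment> \<open>If no zero has real part within \<open>e\<close> of \<open>\<sigma>\<close>,
      then \<open>G4\<close> is zero-free on this strip. The strip is invariant under vertical
      shifts, so all translates are zero-free there too, while their limit \<open>g\<close> vanishes
      at \<open>\<sigma>\<close>.\<close>
    define S where "S = {z. \<sigma> - e < Re z} \<inter> {z. Re z < \<sigma> + e}"
    have S: "z \<in> S \<longleftrightarrow> dist (Re z) \<sigma> < e" for z
      by (auto simp: S_def dist_real_def)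
    have "\<exists>t. \<forall>n. cis (t n * ln 2) = w \<and> dist (cis (t n * ln 3)) v < inverse (real (Suc n))"
      by (intro choice allI) (metis Kronecker_2_3 [OF wv] inverse_positive_iff_positive of_nat_0_less_iff zero_less_Suc)
    then obtain t where t: "\<And>n. cis (t n * ln 2) = w"
      "\<And>n. dist (cis (t n * ln 3)) v < inverse (real (Suc n))"
      by blast
    have "(\<lambda>n. cis (t n * ln 3)) \<longlonglongrightarrow> v"
      by (rule metric_tendsto_imp_tendsto [OF LIMSEQ_inverse_real_of_nat])
         (use t(2) in \<open>auto intro!: always_eventually less_imp_le\<close>)
    have "g (of_real \<sigma>) \<noteq> 0"
    proof (rule Hurwitz_no_zeros [where S = S and \<F> = "\<lambda>n z. G4 (z + \<i> * of_real (t n))" and g = g])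
      show "open S"
        unfolding S_def by (intro open_Int open_halfspace_Re_gt open_halfspace_Re_lt)
      show "connected S"
        unfolding S_def
        by (intro convex_connected convex_Int convex_halfspace_Re_gt convex_halfspace_Re_lt)
      show "(\<lambda>z. G4 (z + \<i> * of_real (t n))) holomorphic_on S" for n
        unfolding G4_def by (intro holomorphic_intros) auto
      show "g holomorphic_on S"
        unfolding g_def by (intro holomorphic_intros) auto
      show "G4 (z + \<i> * of_real (t n)) \<noteq> 0" if "z \<in> S" for n z
        using that by (intro nz) (simp add: S)
      show "complex_of_real \<sigma> \<in> S"
        using \<open>e > 0\<close> by (simp add: S)
      show "uniform_limit K (\<lambda>n z. G4 (z + \<i> * of_real (t n))) g sequentially"
        if "compact K" for K
      proof -
        \<comment> \<open>The phase of 2 equals \<open>w\<close> for every \<open>n\<close>, so only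
          the term with \<open>3 powr z\<close> varies; boundedness on \<open>K\<close> makes its
          convergence uniform.\<close>
        have "bounded ((\<lambda>z::complex. (3::complex) powr z) ` K)"
          using \<open>compact K\<close>
          by (intro compact_imp_bounded compact_continuous_image continuous_intros) auto
        moreover have "uniform_limit K (\<lambda>n z. cis (t n * ln 3)) (\<lambda>z. v) sequentially"
          using tendstoD [OF \<open>(\<lambda>n. cis (t n * ln 3)) \<longlonglongrightarrow> v\<close>]
          by (auto simp: uniform_limit_iff elim: eventually_mono)
        ultimately have "uniform_limit K (\<lambda>n z. cis (t n * ln 3) * 3 powr z) (\<lambda>z. v * 3 powr z) sequentially"
          by (intro uniform_lim_mult uniform_limit_const) (auto simp: image_constant_conv)
        then show ?thesis
          unfolding G4_add_imaginary t(1) g_def by (intro uniform_limit_add uniform_limit_const)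
      qed
      text \<open>A translation along the imaginary axis turns \<open>w\<close> into \<open>1\<close>, and there \<open>g\<close> does not vanish.\<close>
      show "\<not> g constant_on S"
      proof
        assume "g constant_on S"
        then have g0: "g z = 0" if "z \<in> S" for z
          using that g\<sigma> \<open>complex_of_real \<sigma> \<in> S\<close> by (metis constant_on_def)
        have "norm (inverse w) = 1"
          using wv by (simp add: norm_inverse)
        then obtain y where y: "cis (y * ln 2) = inverse w"
          using Kronecker_2_3 [of "inverse w" 1 1] by (metis norm_one zero_less_one)
        define z where "z = of_real \<sigma> + \<i> * of_real y"
        have "w \<noteq> 0"
          using wv by auto
        have p: "w * 2 powr z = of_real (2 powr \<sigma>)"
          using powr_add_imaginary [of 2 "of_real \<sigma>" y] powr_of_real [of 2 \<sigma>] \<open>w \<noteq> 0\<close>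
          by (simp add: z_def y)
        have "z \<in> S"
          using \<open>e > 0\<close> by (simp add: S z_def)
        then have "of_real (1 + 2 powr \<sigma> + (2 powr \<sigma>)\<^sup>2) + v * 3 powr z = 0"
          using g0 [of z] unfolding g_def p by (simp add: ac_simps)
        then have "of_real (1 + 2 powr \<sigma> + (2 powr \<sigma>)\<^sup>2) = - (v * 3 powr z)"
          by (simp only: eq_neg_iff_add_eq_0)
        then have "norm (complex_of_real (1 + 2 powr \<sigma> + (2 powr \<sigma>)\<^sup>2)) = 3 powr \<sigma>"
          by (simp add: norm_mult wv norm_powr_real_powr z_def del: of_real_add)
        then show False
          using three_powr_less [OF \<sigma>(2)] unfolding norm_of_real by linarith
      qed
    qed
    then show False
      using g\<sigma> by simp
  qed
qed

end
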